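(* Let $\|\cdot\|_{N_1}$ be an arbitrary non-differentiable norm on $\mathbb{R}^p$, $\|\cdot\|_{N_2}$ an arbitrary norm on $\mathbb{R}^p$, $\rho>0$, and $\mathcal{S}=\{\bm s\mid\|\bm s\|_{N_2}\le\rho\}$. Let $h_{\bm a,b}$ be a linear classifier with unknown parameters and let $q_{RCF}$ be a robust counterfactual mechanism for it using $\|\cdot\|_{N_1}$ and $\mathcal{S}$. Then with only $p+1$ robust counterfactual queries and $p+1$ factual queries (which may be chosen adaptively, knowing $p$, the two norms and $\rho$ but not $(\bm a,b)$), one can recover hyperplane parameters $(\hat{\bm a},\hat b)$ which are equivalent to the original hyperplane parameters $(\bm a,b)$.
   Context: A linear classifier with parameters $\bm a\in\mathbb{R}^p\setminus\{\bm 0\}$, $b\in\mathbb{R}$ is $h_{\bm a,b}:\mathbb{R}^p\to\{-1,1\}$ with $h_{\bm a,b}(\bm x)=1$ if $\bm a^\top\bm x-b\ge 0$ and $-1$ otherwise. A factual query of $\bm x$ returns $q_F(\bm x):=h_{\bm a,b}(\bm x)\in\{-1,1\}$. Hyperplanes $(\bm a,b)$ and $(\hat{\bm a},\hat b)$ are equivalent if for all $\bm x$: $\hat{\bm a}^\top\bm x-\hat b=0\iff\bm a^\top\bm x-b=0$. A norm is non-differentiable if it is not differentiable at some nonzero point. A robust counterfactual query $q_{RCF}$ maps $\bm x$ to an optimal robust counterfactual: a point $\bm x_{RCF}$ minimizing $\|\bm x_{RCF}-\bm x\|_{N_1}$ subject to $\bm x_{RCF}+\bm s$ having the opposite class to $\bm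 x$ for all $\bm s\in\mathcal{S}$. By convention the closure of the class regions is used: the constraint is $\bm a^\top(\bm x_{RCF}+\bm s)\ge b\ \forall\bm s\in\mathcal{S}$ if $h_{\bm a,b}(\bm x)=-1$, and $\bm a^\top(\bm x_{RCF}+\bm s)\le b\ \forall\bm s\in\mathcal{S}$ if $h_{\bm a,b}(\bm x)=1$. *)

theory Defs
  imports "HOL-Analysis.Analysis"
begin

definition is_norm :: "('v::real_vector \<Rightarrow> real) \<Rightarrow> bool" where
  "is_norm N \<longleftrightarrow>
     (\<forall>x. 0 \<le> N x) \<and>
     (\<forall>x. N x = 0 \<longleftrightarrow> x = 0) \<and>
     (\<forall>c x. N (c *\<^sub>R x) = \<bar>c\<bar> * N x) \<and>
     (\<forall>x y. N (x + y) \<le> N x + N y)"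

definition nondifferentiable_norm :: "('v::real_normed_vector \<Rightarrow> real) \<Rightarrow> bool" where
  "nondifferentiable_norm N \<longleftrightarrow> is_norm N \<and> (\<exists>x. x \<noteq> 0 \<and> \<not> N differentiable (at x))"

definition linear_classifier :: "'v::real_inner \<Rightarrow> real \<Rightarrow> 'v \<Rightarrow> int" where
  "linear_classifier a b x = (if a \<bullet> x - b \<ge> 0 then 1 else -1)"

definition equivalent_hyperplanes ::
    "'v::real_inner \<Rightarrow> real \<Rightarrow> 'v \<Rightarrow> real \<Rightarrow> bool" where
  "equivalent_hyperplanes a' b' a b \<longleftrightarrow> (\<forall>x. a' \<bullet> x - b' = 0 \<longleftrightarrow> a \<bullet> x - b = 0)"

text \<open>
  Both class regions are replaced by their closures, so that an optimal robust
  counterfactual exists for a query point of either class.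
\<close>

definition robust_counterfactual ::
    "'v set \<Rightarrow> 'v::real_inner \<Rightarrow> real \<Rightarrow> 'v \<Rightarrow> 'v \<Rightarrow> bool" where
  "robust_counterfactual S a b x y \<longleftrightarrow>
     (if linear_classifier a b x = -1
      then \<forall>s\<in>S. a \<bullet> (y + s) \<ge> b
      else \<forall>s\<in>S. a \<bullet> (y + s) \<le> b)"

text \<open>
  Optimal robust counterfactuals need not be unique. A mechanism is any function that
  selects one of them for every query point.
\<close>

definition rcf_mechanism ::
    "('v \<Rightarrow> real) \<Rightarrow> 'v set \<Rightarrow> 'v::real_inner \<Rightarrow> real \<Rightarrow> ('v \<Rightarrow> 'v) \<Rightarrow> bool" where
  "rcf_mechanism N S a b q \<longleftrightarrow>
     (\<forall>x. is_arg_min (\<lambda>y. N (y - x)) (robust_counterfactual S a b x) (q x))"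

text \<open>
  A deterministic adaptive query strategy, as a decision tree: an inner node asks a query
  and continues with the subtree selected by the answer; a leaf returns hyperplane
  parameters. The tree can depend on the unknown classifier only through the answers.
\<close>

datatype 'v strategy =
    Recover 'v real
  | Ask_Factual 'v "int \<Rightarrow> 'v strategy"
  | Ask_RCF 'v "'v \<Rightarrow> 'v strategy"

primrec recovered :: "('v \<Rightarrow> int) \<Rightarrow> ('v \<Rightarrow> 'v) \<Rightarrow> 'v strategy \<Rightarrow> 'v \<times> real" where
  "recovered qF qR (Recover a b) = (a, b)"
| "recovered qF qR (Ask_Factual x k) = recovered qF qR (k (qF x))"
| "recovered qF qR (Ask_RCF x k) = recovered qF qR (k (qR x))"

primrec factual_queries :: "('v \<Rightarrow> int) \<Rightarrow> ('v \<Rightarrow> 'v) \<Rightarrow> 'v strategy \<Rightarrow> nat" where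
  "factual_queries qF qR (Recover a b) = 0"
| "factual_queries qF qR (Ask_Factual x k) = Suc (factual_queries qF qR (k (qF x)))"
| "factual_queries qF qR (Ask_RCF x k) = factual_queries qF qR (k (qR x))"

primrec rcf_queries :: "('v \<Rightarrow> int) \<Rightarrow> ('v \<Rightarrow> 'v) \<Rightarrow> 'v strategy \<Rightarrow> nat" where
  "rcf_queries qF qR (Recover a b) = 0"
| "rcf_queries qF qR (Ask_Factual x k) = rcf_queries qF qR (k (qF x))"
| "rcf_queries qF qR (Ask_RCF x k) = Suc (rcf_queries qF qR (k (qR x)))"

end

theory Submission
  imports Defs
begin

text \<open>
  Put \<open>\<sigma> = h(x)\<close>, and write \<open>M\<^sub>1\<close>, \<open>M\<^sub>2\<close> for the dual norms. The points that are
  robustly in the class opposite to \<open>x\<close> form the half-space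
  \<open>\<sigma> (a \<bullet> y - b) + \<rho> M\<^sub>2 a \<le> 0\<close>, which does not contain \<open>x\<close>. Hence every optimal robust
  counterfactual \<open>y\<close> of \<open>x\<close> reveals the distance
  \<open>N\<^sub>1 (y - x) = (\<sigma> (a \<bullet> x - b) + \<rho> M\<^sub>2 a) / M\<^sub>1 a\<close>, and \<open>y - x\<close> is a direction of steepest
  descent for \<open>\<sigma> a\<close>. Consequently the ball of radius \<open>N\<^sub>1 (y - x)\<close> around \<open>x - (y - x)\<close> lies in
  the class of \<open>x\<close>: after one query of each kind at the origin, the distances from \<open>p\<close> points of
  this ball, one for each coordinate, yield the vector \<open>a / M\<^sub>1 a\<close>. Then \<open>b / M\<^sub>1 a\<close> follows
  from the distance from the origin, because \<open>M\<^sub>2 a / M\<^sub>1 a\<close> is now known.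
\<close>

section \<open>Arbitrary norms on a Euclidean space and their duals\<close>

definition dual_norm :: "('v::real_inner \<Rightarrow> real) \<Rightarrow> 'v \<Rightarrow> real" where
  "dual_norm N a = (SUP x\<in>{x. N x \<le> 1}. a \<bullet> x)"

lemma is_norm_nonneg: "is_norm N \<Longrightarrow> 0 \<le> N x"
  and is_norm_eq_0_iff: "is_norm N \<Longrightarrow> N x = 0 \<longleftrightarrow> x = 0"
  and is_norm_scaleR: "is_norm N \<Longrightarrow> N (c *\<^sub>R x) = \<bar>c\<bar> * N x"
  and is_norm_triangle: "is_norm N \<Longrightarrow> N (x + y) \<le> N x + N y"
  unfolding is_norm_def by blast+

lemma is_norm_minus: "is_norm N \<Longrightarrow> N (- x) = N x"
  using is_norm_scaleR[of N "- 1" x] by simp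

lemma is_norm_pos: "is_norm N \<Longrightarrow> x \<noteq> 0 \<Longrightarrow> 0 < N x"
  by (metis is_norm_eq_0_iff is_norm_nonneg less_eq_real_def)

text \<open>\<open>N\<close> need not be the built-in \<open>norm\<close>, so continuity has to be
  derived: in finite dimension it follows from convexity on the open set
  \<open>UNIV\<close>.\<close>

lemma continuous_on_is_norm:
  fixes N :: "'v::euclidean_space \<Rightarrow> real"
  assumes N: "is_norm N"
  shows "continuous_on UNIV N"
proof (rule convex_on_continuous)
  show "convex_on UNIV N"
  proof (rule convex_onI)
    fix t :: real and x y :: 'v
    assume "0 < t" "t < 1"
    then show "N ((1 - t) *\<^sub>R x + t *\<^sub>R y) \<le> (1 - t) * N x + t * N y"
      using is_norm_triangle[OF N, of "(1 - t) *\<^sub>R x" "t *\<^sub>R y"]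
      by (simp add: is_norm_scaleR[OF N])
  qed simp
qed simp

text \<open>On the Euclidean unit sphere \<open>N\<close> attains a positive minimum
  \<open>N e\<close>, so by homogeneity the unit ball of \<open>N\<close> lies in the Euclidean ball
  of radius \<open>1 / N e\<close>.\<close>

lemma compact_unit_ball_is_norm:
  fixes N :: "'v::euclidean_space \<Rightarrow> real"
  assumes N: "is_norm N"
  shows "compact {x. N x \<le> 1}"
proof -
  have "sphere 0 1 \<noteq> ({} :: 'v set)"
    by simp
  then obtain e where e: "e \<in> sphere 0 1" and min: "\<And>x. x \<in> sphere 0 1 \<Longrightarrow> N e \<le> N x"
    using continuous_attains_inf[of "sphere 0 1" N] continuous_on_subset[OF continuous_on_is_norm[OF N]]
    by (metis compact_sphere subset_UNIV)
  have pos: "0 < N e"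
    using is_norm_pos[OF N, of e] e by fastforce
  have "norm x \<le> 1 / N e" if "N x \<le> 1" for x
  proof (cases "x = 0")
    case False
    then have "N e \<le> N ((1 / norm x) *\<^sub>R x)"
      by (intro min) simp
    also have "\<dots> = N x / norm x"
      by (simp add: is_norm_scaleR[OF N])
    also have "\<dots> \<le> 1 / norm x"
      using that by (simp add: divide_right_mono)
    finally show ?thesis
      using False pos by (simp add: field_simps)
  qed (use pos in simp)
  then have "bounded {x. N x \<le> 1}"
    unfolding bounded_iff by blast
  moreover have "closed {x. N x \<le> 1}"
    using continuous_on_is_norm[OF N] by (intro closed_Collect_le) auto
  ultimately show ?thesis
    by (simp add: compact_eq_bounded_closed)
qed

text \<open>Compactness of the unit ball turns the supremum into a maximum. The maximizer later
  serves both as worst perturbation and as direction of steepest ascent.\<close>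

lemma
  fixes N :: "'v::euclidean_space \<Rightarrow> real"
  assumes N: "is_norm N"
  shows dual_norm_attained: "\<exists>u. N u \<le> 1 \<and> a \<bullet> u = dual_norm N a"
    and inner_le_dual_norm: "N x \<le> 1 \<Longrightarrow> a \<bullet> x \<le> dual_norm N a"
proof -
  have "N 0 \<le> 1"
    using is_norm_eq_0_iff[OF N, of 0] by simp
  then have ne: "{x. N x \<le> 1} \<noteq> {}"
    by blast
  obtain u where u: "N u \<le> 1" and max: "\<And>x. N x \<le> 1 \<Longrightarrow> a \<bullet> x \<le> a \<bullet> u"
  proof -
    have "continuous_on {x. N x \<le> 1} ((\<bullet>) a)"
      by (intro continuous_intros)
    from continuous_attains_sup[OF compact_unit_ball_is_norm[OF N] ne this] that
    show ?thesis by auto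
  qed
  have "dual_norm N a = a \<bullet> u"
    unfolding dual_norm_def using u max by (intro cSup_eq_maximum) auto
  then show "\<exists>u. N u \<le> 1 \<and> a \<bullet> u = dual_norm N a" "N x \<le> 1 \<Longrightarrow> a \<bullet> x \<le> dual_norm N a"
    using u max by auto
qed

lemma inner_le_dual_norm_mult:
  fixes N :: "'v::euclidean_space \<Rightarrow> real"
  assumes N: "is_norm N"
  shows "a \<bullet> x \<le> dual_norm N a * N x"
proof (cases "x = 0")
  case False
  then have pos: "0 < N x"
    using is_norm_pos[OF N] by blast
  then have "a \<bullet> ((1 / N x) *\<^sub>R x) \<le> dual_norm N a"
    by (intro inner_le_dual_norm[OF N]) (simp add: is_norm_scaleR[OF N])
  then show ?thesis
    using pos by (simp add: field_simps)
next
  case True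
  then show ?thesis
    using is_norm_eq_0_iff[OF N, of 0] by simp
qed

lemma abs_inner_le_dual_norm_mult:
  fixes N :: "'v::euclidean_space \<Rightarrow> real"
  assumes N: "is_norm N"
  shows "\<bar>a \<bullet> x\<bar> \<le> dual_norm N a * N x"
  using inner_le_dual_norm_mult[OF N, of a x] inner_le_dual_norm_mult[OF N, of a "- x"]
  by (simp add: is_norm_minus[OF N] abs_le_iff)

lemma dual_norm_pos:
  fixes N :: "'v::euclidean_space \<Rightarrow> real"
  assumes N: "is_norm N" and "a \<noteq> 0"
  shows "0 < dual_norm N a"
proof -
  have "0 < a \<bullet> a"
    using assms by simp
  also have "\<dots> \<le> dual_norm N a * N a"
    by (rule inner_le_dual_norm_mult[OF N])
  finally show ?thesis
    using is_norm_pos[OF assms] by (simp add: zero_less_mult_iff)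
qed

lemma dual_norm_scaleR:
  fixes N :: "'v::euclidean_space \<Rightarrow> real"
  assumes N: "is_norm N" and "0 \<le> c"
  shows "dual_norm N (c *\<^sub>R a) = c * dual_norm N a"
proof (rule antisym)
  show "dual_norm N (c *\<^sub>R a) \<le> c * dual_norm N a"
    using dual_norm_attained[OF N, of "c *\<^sub>R a"] inner_le_dual_norm[OF N, of _ a] \<open>0 \<le> c\<close>
    by (metis inner_scaleR_left mult_left_mono)
  show "c * dual_norm N a \<le> dual_norm N (c *\<^sub>R a)"
    using dual_norm_attained[OF N, of a] inner_le_dual_norm[OF N, of _ "c *\<^sub>R a"]
    by (metis inner_scaleR_left)
qed

text \<open>Only the worst perturbation matters, namely \<open>\<rho>\<close> times a maximizer for
  the dual norm.\<close>

lemma inner_bounded_on_ball_iff: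
  fixes N :: "'v::euclidean_space \<Rightarrow> real"
  assumes N: "is_norm N" and "\<rho> > 0"
  shows "(\<forall>s\<in>{s. N s \<le> \<rho>}. a \<bullet> s \<le> t) \<longleftrightarrow> \<rho> * dual_norm N a \<le> t"
proof
  obtain u where u: "N u \<le> 1" "a \<bullet> u = dual_norm N a"
    using dual_norm_attained[OF N] by blast
  assume "\<forall>s\<in>{s. N s \<le> \<rho>}. a \<bullet> s \<le> t"
  moreover have "N (\<rho> *\<^sub>R u) \<le> \<rho>"
    using u \<open>\<rho> > 0\<close> by (simp add: is_norm_scaleR[OF N])
  ultimately have "a \<bullet> (\<rho> *\<^sub>R u) \<le> t"
    by blast
  then show "\<rho> * dual_norm N a \<le> t"
    using u by simp
next
  assume t: "\<rho> * dual_norm N a \<le> t"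
  have "a \<bullet> s \<le> t" if "N s \<le> \<rho>" for s
  proof -
    have "a \<bullet> ((1 / \<rho>) *\<^sub>R s) \<le> dual_norm N a"
      using that \<open>\<rho> > 0\<close> by (intro inner_le_dual_norm[OF N]) (simp add: is_norm_scaleR[OF N])
    then show ?thesis
      using t \<open>\<rho> > 0\<close> by (simp add: field_simps)
  qed
  then show "\<forall>s\<in>{s. N s \<le> \<rho>}. a \<bullet> s \<le> t"
    by blast
qed

section \<open>The robust half-space and the optimal robust counterfactuals\<close>

lemma robust_counterfactual_iff:
  fixes N :: "'v::euclidean_space \<Rightarrow> real"
  assumes N: "is_norm N" and "\<rho> > 0"
  shows "robust_counterfactual {s. N s \<le> \<rho>} a b x y \<longleftrightarrow>
    linear_classifier a b x * (a \<bullet> y - b) + \<rho> * dual_norm N a \<le> 0"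
proof (cases "linear_classifier a b x = -1")
  case True
  \<comment> \<open>The ball is symmetric, so replacing \<open>s\<close> by \<open>- s\<close> turns
    the lower bound into the upper bound handled before.\<close>
  have "(\<forall>s\<in>{s. N s \<le> \<rho>}. a \<bullet> (y + s) \<ge> b) \<longleftrightarrow> (\<forall>s\<in>{s. N s \<le> \<rho>}. a \<bullet> s \<le> a \<bullet> y - b)"
    (is "?l \<longleftrightarrow> ?r")
  proof
    assume l: ?l
    show ?r
    proof
      fix s assume "s \<in> {s. N s \<le> \<rho>}"
      then have "b \<le> a \<bullet> (y + - s)"
        using l is_norm_minus[OF N] by (metis mem_Collect_eq)
      then show "a \<bullet> s \<le> a \<bullet> y - b"
        by (simp add: inner_diff_right)
    qed
  next
    assume r: ?r
    show ?l
    proof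
      fix s assume "s \<in> {s. N s \<le> \<rho>}"
      then have "a \<bullet> (- s) \<le> a \<bullet> y - b"
        using r is_norm_minus[OF N] by (metis mem_Collect_eq)
      then show "b \<le> a \<bullet> (y + s)"
        by (simp add: inner_add_right)
    qed
  qed
  then show ?thesis
    using True inner_bounded_on_ball_iff[OF assms, of a "a \<bullet> y - b"]
    by (auto simp: robust_counterfactual_def)
next
  case False
  then have "linear_classifier a b x = 1"
    by (simp add: linear_classifier_def split: if_splits)
  moreover have "(\<forall>s\<in>{s. N s \<le> \<rho>}. a \<bullet> (y + s) \<le> b) \<longleftrightarrow> (\<forall>s\<in>{s. N s \<le> \<rho>}. a \<bullet> s \<le> b - a \<bullet> y)"
    by (simp add: inner_add_right algebra_simps)
  ultimately show ?thesis
    using inner_bounded_on_ball_iff[OF assms, of a "b - a \<bullet> y"]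
    by (auto simp: robust_counterfactual_def)
qed

lemma linear_classifier_cases: "linear_classifier a b x = 1 \<or> linear_classifier a b x = -1"
  by (simp add: linear_classifier_def)

lemma linear_classifier_mult_nonneg: "0 \<le> linear_classifier a b x * (a \<bullet> x - b)"
  by (simp add: linear_classifier_def)

lemma linear_classifier_cong:
  assumes "linear_classifier a b x * (a \<bullet> x) \<le> linear_classifier a b x * (a \<bullet> y)"
  shows "linear_classifier a b y = linear_classifier a b x"
  using assms by (auto simp: linear_classifier_def split: if_splits)

text \<open>A feasible point built from a maximizer for the dual norm bounds the distance from
  above; feasibility of \<open>q x\<close> bounds it from below by the same value. Equality forces
  \<open>q x - x\<close> to be extremal, whichever optimum \<open>q\<close> selects.\<close>

lemma
  fixes N1 N2 :: "'v::euclidean_space \<Rightarrow> real"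
  assumes N1: "is_norm N1" and N2: "is_norm N2" and "\<rho> > 0" and "a \<noteq> 0"
    and q: "rcf_mechanism N1 {s. N2 s \<le> \<rho>} a b q"
  shows rcf_mechanism_distance: "dual_norm N1 a * N1 (q x - x) =
      linear_classifier a b x * (a \<bullet> x - b) + \<rho> * dual_norm N2 a"
    and rcf_mechanism_direction: "linear_classifier a b x * (a \<bullet> (q x - x)) =
      - (dual_norm N1 a * N1 (q x - x))"
proof -
  define \<sigma> where "\<sigma> = real_of_int (linear_classifier a b x)"
  define g where "g = \<sigma> * (a \<bullet> x - b) + \<rho> * dual_norm N2 a"
  have \<sigma>: "\<sigma> = 1 \<or> \<sigma> = -1"
    using linear_classifier_cases[of a b x] by (auto simp: \<sigma>_def)
  have M1: "0 < dual_norm N1 a"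
    by (rule dual_norm_pos[OF N1 \<open>a \<noteq> 0\<close>])
  have "0 < \<rho> * dual_norm N2 a"
    using dual_norm_pos[OF N2 \<open>a \<noteq> 0\<close>] \<open>\<rho> > 0\<close> by simp
  then have g: "0 < g"
    using linear_classifier_mult_nonneg[of a b x] by (simp add: g_def \<sigma>_def)
  note feasible = robust_counterfactual_iff[OF N2 \<open>\<rho> > 0\<close>, of a b x, folded \<sigma>_def]
  have "is_arg_min (\<lambda>y. N1 (y - x)) (robust_counterfactual {s. N2 s \<le> \<rho>} a b x) (q x)"
    using q unfolding rcf_mechanism_def by blast
  then have qx: "robust_counterfactual {s. N2 s \<le> \<rho>} a b x (q x)"
    and opt: "\<And>y. robust_counterfactual {s. N2 s \<le> \<rho>} a b x y \<Longrightarrow> N1 (q x - x) \<le> N1 (y - x)"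
    by (auto simp: is_arg_min_linorder)
  obtain u where u: "N1 u \<le> 1" "a \<bullet> u = dual_norm N1 a"
    using dual_norm_attained[OF N1] by blast
  \<comment> \<open>Starting at \<open>x\<close>, the step against \<open>\<sigma>\<close> along
    \<open>u\<close> is just long enough to reach the boundary of the robust half-space.\<close>
  define z where "z = x - (\<sigma> * (g / dual_norm N1 a)) *\<^sub>R u"
  have "\<sigma> * (a \<bullet> z - b) + \<rho> * dual_norm N2 a = 0"
    using \<sigma> M1 u by (auto simp: z_def g_def inner_diff_right)
  then have "N1 (q x - x) \<le> N1 (z - x)"
    using feasible[of z] by (intro opt) simp
  also have "\<dots> = g / dual_norm N1 a * N1 u"
    using \<sigma> g M1 by (auto simp: z_def is_norm_minus[OF N1] is_norm_scaleR[OF N1])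
  also have "\<dots> \<le> g / dual_norm N1 a"
    using g M1 u by (intro mult_left_le) simp_all
  finally have upper: "dual_norm N1 a * N1 (q x - x) \<le> g"
    using M1 by (simp add: field_simps)
  \<comment> \<open>Together with \<open>upper\<close>, the next two inequalities form a cycle, so
    all three quantities coincide.\<close>
  have "g \<le> - \<sigma> * (a \<bullet> (q x - x))"
    using feasible[of "q x"] qx by (simp add: g_def inner_diff_right algebra_simps)
  moreover have "- \<sigma> * (a \<bullet> (q x - x)) \<le> dual_norm N1 a * N1 (q x - x)"
    using \<sigma> abs_inner_le_dual_norm_mult[OF N1, of a "q x - x"] by auto
  ultimately show "dual_norm N1 a * N1 (q x - x) =
      linear_classifier a b x * (a \<bullet> x - b) + \<rho> * dual_norm N2 a"
    "linear_classifier a b x * (a \<bullet> (q x - x)) = - (dual_norm N1 a * N1 (q x - x))"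
    using upper unfolding g_def \<sigma>_def by linarith+
qed

section \<open>The query strategy\<close>

primrec ask_rcf_list ::
    "'v list \<Rightarrow> ('v \<Rightarrow> 'v) \<Rightarrow> (('v \<Rightarrow> 'v) \<Rightarrow> 'v strategy) \<Rightarrow> 'v strategy" where
  "ask_rcf_list [] f k = k f"
| "ask_rcf_list (x # xs) f k = Ask_RCF x (\<lambda>y. ask_rcf_list xs (f(x := y)) k)"

text \<open>The batch collects its answers in a table indexed by query point, with \<open>f\<close>
  as default elsewhere; a repeated point is counted each time.\<close>

lemma ask_rcf_list_run:
  shows recovered_ask_rcf_list: "recovered qF qR (ask_rcf_list xs f k) =
      recovered qF qR (k (\<lambda>x. if x \<in> set xs then qR x else f x))"
    and rcf_queries_ask_rcf_list: "rcf_queries qF qR (ask_rcf_list xs f k) =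
      length xs + rcf_queries qF qR (k (\<lambda>x. if x \<in> set xs then qR x else f x))"
    and factual_queries_ask_rcf_list: "factual_queries qF qR (ask_rcf_list xs f k) =
      factual_queries qF qR (k (\<lambda>x. if x \<in> set xs then qR x else f x))"
proof (induction xs arbitrary: f)
  case (Cons x xs)
  have eq: "(\<lambda>z. if z \<in> set xs then qR z else (f(x := qR x)) z) =
      (\<lambda>z. if z \<in> set (x # xs) then qR z else f z)" for f
    by auto
  {
    case 1
    show ?case
      using Cons.IH(1) by (simp only: eq ask_rcf_list.simps recovered.simps)
  next
    case 2
    show ?case
      using Cons.IH(2) by (simp only: eq ask_rcf_list.simps rcf_queries.simps list.size
          add_Suc_right add_Suc add_0_right)
  next
    case 3
    show ?case
      using Cons.IH(3) by (simp only: eq ask_rcf_list.simps factual_queries.simps)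
  }
qed simp_all

text \<open>A point of the \<open>N\<close>-sphere of radius \<open>N y\<close> around
  \<open>- y\<close>: the factor \<open>N y / N u\<close> is the longest step along \<open>u\<close>
  within that ball.\<close>

definition probe :: "('v::real_vector \<Rightarrow> real) \<Rightarrow> 'v \<Rightarrow> 'v \<Rightarrow> 'v" where
  "probe N y u = - y + (N y / N u) *\<^sub>R u"

text \<open>
  The answer at the center \<open>- y\<close> of the ball would have distance \<open>2 * N y\<close>, so that the
  coordinates of the normal are difference quotients of distances.
\<close>

definition recovered_normal ::
    "('v::euclidean_space \<Rightarrow> real) \<Rightarrow> int \<Rightarrow> 'v \<Rightarrow> ('v \<Rightarrow> 'v) \<Rightarrow> 'v" where
  "recovered_normal N \<sigma> y f =
     (\<Sum>u\<in>Basis. (\<sigma> * (N (f (probe N y u) - probe N y u) - 2 * N y) / (N y / N u)) *\<^sub>R u)"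

text \<open>This is the distance formula at the origin solved for the offset, for a normal
  \<open>a\<close> scaled to dual \<open>N1\<close>-norm one.\<close>

definition recovered_offset ::
    "('v::euclidean_space \<Rightarrow> real) \<Rightarrow> ('v \<Rightarrow> real) \<Rightarrow> real \<Rightarrow> int \<Rightarrow> 'v \<Rightarrow> 'v \<Rightarrow> real" where
  "recovered_offset N1 N2 \<rho> \<sigma> y a = \<sigma> * (\<rho> * dual_norm N2 a - N1 y)"

text \<open>The list \<open>us\<close> is meant to enumerate \<open>Basis\<close>. All probes share
  the class of the origin, so one factual query suffices.\<close>

definition recovery_strategy ::
    "('v::euclidean_space \<Rightarrow> real) \<Rightarrow> ('v \<Rightarrow> real) \<Rightarrow> real \<Rightarrow> 'v list \<Rightarrow> 'v strategy" where
  "recovery_strategy N1 N2 \<rho> us =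
     Ask_Factual 0 (\<lambda>\<sigma>. Ask_RCF 0 (\<lambda>y. ask_rcf_list (map (probe N1 y) us) id
       (\<lambda>f. let a = recovered_normal N1 \<sigma> y f in Recover a (recovered_offset N1 N2 \<rho> \<sigma> y a))))"

lemma
  shows rcf_queries_recovery_strategy:
      "rcf_queries qF qR (recovery_strategy N1 N2 \<rho> us) = length us + 1"
    and factual_queries_recovery_strategy:
      "factual_queries qF qR (recovery_strategy N1 N2 \<rho> us) = 1"
  by (simp_all add: recovery_strategy_def Let_def rcf_queries_ask_rcf_list
      factual_queries_ask_rcf_list)

section \<open>Correctness of the recovered parameters\<close>

lemma recovered_normal_eq:
  fixes N1 N2 :: "'v::euclidean_space \<Rightarrow> real"
  assumes N1: "is_norm N1" and N2: "is_norm N2" and "\<rho> > 0" and "a \<noteq> 0"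
    and q: "rcf_mechanism N1 {s. N2 s \<le> \<rho>} a b q"
    and f: "\<And>u. u \<in> Basis \<Longrightarrow> f (probe N1 (q 0) u) = q (probe N1 (q 0) u)"
  shows "recovered_normal N1 (linear_classifier a b 0) (q 0) f = (1 / dual_norm N1 a) *\<^sub>R a"
proof -
  define \<sigma> where "\<sigma> = linear_classifier a b 0"
  define M where "M = dual_norm N1 a"
  have \<sigma>: "\<sigma> = 1 \<or> \<sigma> = -1"
    unfolding \<sigma>_def by (rule linear_classifier_cases)
  have M: "0 < M"
    unfolding M_def by (rule dual_norm_pos[OF N1 \<open>a \<noteq> 0\<close>])
  note distance = rcf_mechanism_distance[OF N1 N2 \<open>\<rho> > 0\<close> \<open>a \<noteq> 0\<close> q, folded M_def]
  have distance0: "M * N1 (q 0) = - (\<sigma> * b) + \<rho> * dual_norm N2 a"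
    using distance[of 0] by (simp add: \<sigma>_def)
  have direction0: "\<sigma> * (a \<bullet> q 0) = - (M * N1 (q 0))"
    using rcf_mechanism_direction[OF N1 N2 \<open>\<rho> > 0\<close> \<open>a \<noteq> 0\<close> q, of 0] by (simp add: \<sigma>_def M_def)
  \<comment> \<open>The robustness margin keeps the ball nondegenerate even if the origin lies on
    the hyperplane.\<close>
  have "0 < \<rho> * dual_norm N2 a"
    using dual_norm_pos[OF N2 \<open>a \<noteq> 0\<close>] \<open>\<rho> > 0\<close> by simp
  then have "0 < M * N1 (q 0)"
    using distance0 linear_classifier_mult_nonneg[of a b 0] by (simp add: \<sigma>_def)
  then have n: "0 < N1 (q 0)"
    using M by (simp add: zero_less_mult_iff)
  have coord: "\<sigma> * (N1 (f (probe N1 (q 0) u) - probe N1 (q 0) u) - 2 * N1 (q 0)) / (N1 (q 0) / N1 u)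
      = (a \<bullet> u) / M" if u: "u \<in> Basis" for u
  proof -
    define z where "z = probe N1 (q 0) u"
    define \<epsilon> where "\<epsilon> = N1 (q 0) / N1 u"
    have Nu: "0 < N1 u"
      using is_norm_pos[OF N1] u nonzero_Basis by blast
    then have \<epsilon>: "0 < \<epsilon>"
      using n by (simp add: \<epsilon>_def)
    have az: "\<sigma> * (a \<bullet> z) = M * N1 (q 0) + \<epsilon> * (\<sigma> * (a \<bullet> u))"
      using direction0 by (simp add: z_def probe_def \<epsilon>_def inner_add_right algebra_simps)
    \<comment> \<open>Along \<open>u\<close> the score drops by at most \<open>M * N1 u\<close> per
      unit, so the step \<open>\<epsilon>\<close> loses at most the \<open>M * N1 (q 0)\<close>
      gained at the center \<open>- q 0\<close>. Hence the probe stays in the class of the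
      origin.\<close>
    have "- (\<sigma> * (a \<bullet> u)) \<le> M * N1 u"
      using \<sigma> abs_inner_le_dual_norm_mult[OF N1, of a u] unfolding M_def by auto
    then have "\<epsilon> * - (\<sigma> * (a \<bullet> u)) \<le> \<epsilon> * (M * N1 u)"
      using \<epsilon> by (intro mult_left_mono) auto
    also have "\<dots> = M * N1 (q 0)"
      using Nu by (simp add: \<epsilon>_def)
    finally have "0 \<le> \<sigma> * (a \<bullet> z)"
      using az by simp
    then have "linear_classifier a b z = \<sigma>"
      unfolding \<sigma>_def by (intro linear_classifier_cong) simp
    then have "M * N1 (q z - z) = \<sigma> * (a \<bullet> z) - \<sigma> * b + \<rho> * dual_norm N2 a"
      using distance[of z] by (simp add: algebra_simps)
    \<comment> \<open>With the class unchanged, the distance is affine in the probe, and subtracting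
      its value at the center removes the unknown \<open>b\<close> and \<open>\<rho>\<close>
      terms.\<close>
    then have "M * (N1 (q z - z) - 2 * N1 (q 0)) = \<epsilon> * (\<sigma> * (a \<bullet> u))"
      using az distance0 by (simp add: algebra_simps)
    then have "N1 (q z - z) - 2 * N1 (q 0) = \<epsilon> * (\<sigma> * (a \<bullet> u)) / M"
      using M by (simp add: field_simps)
    then have "\<sigma> * (N1 (q z - z) - 2 * N1 (q 0)) / \<epsilon> = (a \<bullet> u) / M"
      using \<sigma> \<epsilon> by auto
    then show ?thesis
      using f[OF u] by (simp add: z_def \<epsilon>_def)
  qed
  have "recovered_normal N1 \<sigma> (q 0) f = (\<Sum>u\<in>Basis. ((a \<bullet> u) / M) *\<^sub>R u)"
    unfolding recovered_normal_def by (intro sum.cong refl) (simp only: coord)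
  also have "\<dots> = (\<Sum>u\<in>Basis. (((1 / M) *\<^sub>R a) \<bullet> u) *\<^sub>R u)"
    by simp
  also have "\<dots> = (1 / M) *\<^sub>R a"
    by (rule euclidean_representation)
  finally show ?thesis
    by (simp add: \<sigma>_def M_def)
qed

lemma recovered_offset_eq:
  fixes N1 N2 :: "'v::euclidean_space \<Rightarrow> real"
  assumes N1: "is_norm N1" and N2: "is_norm N2" and "\<rho> > 0" and "a \<noteq> 0"
    and q: "rcf_mechanism N1 {s. N2 s \<le> \<rho>} a b q"
  shows "recovered_offset N1 N2 \<rho> (linear_classifier a b 0) (q 0) ((1 / dual_norm N1 a) *\<^sub>R a) =
    b / dual_norm N1 a"
proof -
  have "0 < dual_norm N1 a"
    by (rule dual_norm_pos[OF N1 \<open>a \<noteq> 0\<close>])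
  then show ?thesis
    using rcf_mechanism_distance[OF assms, of 0] linear_classifier_cases[of a b 0]
    by (auto simp: recovered_offset_def dual_norm_scaleR[OF N2] field_simps)
qed

lemma recovered_recovery_strategy:
  fixes N1 N2 :: "'v::euclidean_space \<Rightarrow> real"
  assumes "is_norm N1" and "is_norm N2" and "\<rho> > 0" and "a \<noteq> 0"
    and "rcf_mechanism N1 {s. N2 s \<le> \<rho>} a b q" and "set us = Basis"
  shows "recovered (linear_classifier a b) q (recovery_strategy N1 N2 \<rho> us) =
    ((1 / dual_norm N1 a) *\<^sub>R a, b / dual_norm N1 a)"
  using assms recovered_normal_eq[OF assms(1-5)] recovered_offset_eq[OF assms(1-5)]
  by (simp add: recovery_strategy_def recovered_ask_rcf_list Let_def)

lemma equivalent_hyperplanes_scale: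
  assumes "c \<noteq> 0"
  shows "equivalent_hyperplanes ((1 / c) *\<^sub>R a) (b / c) a b"
  using assms by (simp add: equivalent_hyperplanes_def field_simps)

theorem corollary21:
  fixes N1 N2 :: "real ^ 'p \<Rightarrow> real" and \<rho> :: real
  assumes "nondifferentiable_norm N1"
    and "is_norm N2"
    and "\<rho> > 0"
  shows "\<exists>strat :: (real ^ 'p) strategy.
           \<forall>(a :: real ^ 'p) (b :: real) (qR :: real ^ 'p \<Rightarrow> real ^ 'p).
             a \<noteq> 0 \<longrightarrow> rcf_mechanism N1 {s. N2 s \<le> \<rho>} a b qR \<longrightarrow>
               rcf_queries (linear_classifier a b) qR strat \<le> CARD('p) + 1 \<and>
               factual_queries (linear_classifier a b) qR strat \<le> CARD('p) + 1 \<and>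
               (\<exists>a' b'. recovered (linear_classifier a b) qR strat = (a', b') \<and>
                        a' \<noteq> 0 \<and> equivalent_hyperplanes a' b' a b)"
proof -
  have N1: "is_norm N1"
    using assms(1) by (simp add: nondifferentiable_norm_def)
  \<comment> \<open>The list depends on the dimension alone, so the strategy is fixed before
    \<open>a\<close> and \<open>b\<close>. Its length plus the query at the origin exhausts the
    budget of robust queries.\<close>
  obtain us :: "(real ^ 'p) list" where us: "set us = Basis" "length us = CARD('p)"
    by (metis DIM_cart DIM_real finite_Basis finite_distinct_list distinct_card mult_1_right)
  show ?thesis
  proof (intro exI[of _ "recovery_strategy N1 N2 \<rho> us"] allI impI)
    fix a b qR
    assume a: "a \<noteq> 0" and q: "rcf_mechanism N1 {s. N2 s \<le> \<rho>} a b qR"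
    have "dual_norm N1 a \<noteq> 0"
      using dual_norm_pos[OF N1 a] by simp
    then show "rcf_queries (linear_classifier a b) qR (recovery_strategy N1 N2 \<rho> us) \<le> CARD('p) + 1 \<and>
        factual_queries (linear_classifier a b) qR (recovery_strategy N1 N2 \<rho> us) \<le> CARD('p) + 1 \<and>
        (\<exists>a' b'. recovered (linear_classifier a b) qR (recovery_strategy N1 N2 \<rho> us) = (a', b') \<and>
          a' \<noteq> 0 \<and> equivalent_hyperplanes a' b' a b)"
      using recovered_recovery_strategy[OF N1 assms(2,3) a q us(1)] a
      by (simp add: rcf_queries_recovery_strategy factual_queries_recovery_strategy us(2)
          equivalent_hyperplanes_scale)
  qed
qed

end
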